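(* Let $e\geq0$ be an integer and let $s\in\mathbb{Z}$. Then $$\bigl\{\alpha^{s}(\lambda) : \lambda \text{ is an } e\text{-core}\bigr\} = \bigl\{\alpha\in Q : \mathsf{w}^{s}(\alpha)=0\bigr\}.$$
   Context: For $e=0$ we have $\mathbb{Z}/e\mathbb{Z}=\mathbb{Z}$. A partition is a finite non-increasing sequence $\lambda=(\lambda_1\ge\dots\ge\lambda_h>0)$ of positive integers (possibly empty), with Young diagram $\mathcal{Y}(\lambda)=\{(a,b):1\le a\le h,\ 1\le b\le\lambda_a\}$. A rim hook of $\lambda$ is a set $\{(a',b')\in\mathcal{Y}(\lambda): a'\ge a,\ b'\ge b,\ (a'+1,b'+1)\notin\mathcal{Y}(\lambda)\}$ for some $(a,b)\in\mathcal{Y}(\lambda)$; $\lambda$ is an $e$-core if it has no rim hook of cardinality $e$ (so every partition is a $0$-core). The $s$-residue of a node $(a,b)\in\mathcal{Y}(\lambda)$ is $b-a+s\bmod e\in\mathbb{Z}/e\mathbb{Z}$, and $c_i^s(\lambda)$ is the number of nodes of $\lambda$ of $s$-residue $i$. $Q=\bigoplus_{i\in\mathbb{Z}/e\mathbb{Z}}\mathbb{Z}\alpha_i$ is free abelian with basis $(\alpha_i)$ (finite support when $e=0$), and $\alpha^s(\lambda):=\sum_ic_i^s(\lambda)\alpha_i$. For $\alpha=\sum_ic_i\alpha_i\in Q$, $\mathsf{w}^s(\alpha):=c_s-\frac12\sum_{i\in\mathbb{Z}/e\mathbb{Z}}(c_i-c_{i+1})^2$, the index $s$ being read modulo $e$.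 *)

theory Defs
  imports Complex_Main "HOL-Algebra.Free_Abelian_Groups"
begin

definition is_partition :: "nat list \<Rightarrow> bool" where
  "is_partition lam \<longleftrightarrow> sorted_wrt (\<ge>) lam \<and> (\<forall>x\<in>set lam. x > 0)"

(* Nodes are indexed from 1, whereas list positions are counted from 0. *)
definition young_diagram :: "nat list \<Rightarrow> (nat \<times> nat) set" where
  "young_diagram lam = {(a, b). 1 \<le> a \<and> a \<le> length lam \<and> 1 \<le> b \<and> b \<le> lam ! (a - 1)}"

definition rim_hook :: "nat list \<Rightarrow> nat \<times> nat \<Rightarrow> (nat \<times> nat) set" where
  "rim_hook lam = (\<lambda>(a, b). {(a', b'). (a', b') \<in> young_diagram lam \<and> a' \<ge> a \<and> b' \<ge> b \<and>
     (a' + 1, b' + 1) \<notin> young_diagram lam})"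

definition is_core :: "nat \<Rightarrow> nat list \<Rightarrow> bool" where
  "is_core e lam \<longleftrightarrow> is_partition lam \<and> \<not> (\<exists>x\<in>young_diagram lam. card (rim_hook lam x) = e)"

(* The elements of Z/eZ are represented by the integers fixed by reduction modulo e: these are
   0, ..., e - 1 if e > 0, and all integers if e = 0, since i mod 0 = i in HOL. *)
definition Zmod :: "nat \<Rightarrow> int set" where
  "Zmod e = range (\<lambda>i. i mod int e)"

definition residue :: "nat \<Rightarrow> int \<Rightarrow> nat \<times> nat \<Rightarrow> int" where
  "residue e s = (\<lambda>(a, b). (int b - int a + s) mod int e)"

definition residue_count :: "nat \<Rightarrow> int \<Rightarrow> nat list \<Rightarrow> int \<Rightarrow> nat" where
  "residue_count e s lam i = card {x \<in> young_diagram lam. residue e s x = i}"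

(* The basis element alpha_i is frag_of i, and the coefficient of alpha_i in an element c is
   Poly_Mapping.lookup c i. *)
definition root_lattice :: "nat \<Rightarrow> (int \<Rightarrow>\<^sub>0 int) monoid" where
  "root_lattice e = free_Abelian_group (Zmod e)"

(* Sum_any is the sum of a finitely supported family. *)
definition alpha :: "nat \<Rightarrow> int \<Rightarrow> nat list \<Rightarrow> (int \<Rightarrow>\<^sub>0 int)" where
  "alpha e s lam =
     Sum_any (\<lambda>i. if i \<in> Zmod e then frag_cmul (int (residue_count e s lam i)) (frag_of i) else 0)"

definition weight :: "nat \<Rightarrow> int \<Rightarrow> (int \<Rightarrow>\<^sub>0 int) \<Rightarrow> rat" where
  "weight e s c =
     of_int (Poly_Mapping.lookup c (s mod int e)) -
     1 / 2 * of_int (Sum_any (\<lambda>i. if i \<in> Zmod e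
        then (Poly_Mapping.lookup c i - Poly_Mapping.lookup c ((i + 1) mod int e))\<^sup>2 else 0))"

lemma Zmod_0: "Zmod 0 = UNIV"
  by (simp add: Zmod_def)

lemma Zmod_pos: "e > 0 \<Longrightarrow> Zmod e = {0..<int e}"
  by (force simp: Zmod_def image_iff intro: mod_pos_pos_trivial[symmetric])

lemma finite_young_diagram: "finite (young_diagram lam)"
proof (rule finite_subset)
  show "young_diagram lam \<subseteq> (SIGMA a:{1..length lam}. {1..lam ! (a - 1)})"
    by (auto simp: young_diagram_def)
qed simp

lemma finite_residue_count: "finite {i. residue_count e s lam i \<noteq> 0}"
proof (rule finite_subset)
  show "{i. residue_count e s lam i \<noteq> 0} \<subseteq> residue e s ` young_diagram lam"
  proof
    fix i assume "i \<in> {i. residue_count e s lam i \<noteq> 0}"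
    then have "card {x \<in> young_diagram lam. residue e s x = i} \<noteq> 0"
      by (simp only: residue_count_def mem_Collect_eq not_False_eq_True)
    then have "{x \<in> young_diagram lam. residue e s x = i} \<noteq> {}"
      by (rule contrapos_nn) (simp only: card.empty)
    then show "i \<in> residue e s ` young_diagram lam" by auto
  qed
qed (simp add: finite_young_diagram)

lemma residue_count_outside: "i \<notin> Zmod e \<Longrightarrow> residue_count e s lam i = 0"
  by (auto simp: residue_count_def residue_def Zmod_def card_eq_0_iff)

lemma finite_alpha_support:
  "finite {i. (if i \<in> Zmod e then frag_cmul (int (residue_count e s lam i)) (frag_of i) else 0) \<noteq> 0}"
  by (rule finite_subset[OF _ finite_residue_count[of e s lam]]) auto

lemma lookup_alpha: "Poly_Mapping.lookup (alpha e s lam) i = int (residue_count e s lam i)"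
proof -
  let ?g = "\<lambda>i. if i \<in> Zmod e then frag_cmul (int (residue_count e s lam i)) (frag_of i) else 0"
  let ?A = "insert i {i. residue_count e s lam i \<noteq> 0}"
  have fin: "finite ?A" using finite_residue_count by simp
  have "{j. ?g j \<noteq> 0} \<subseteq> ?A"
  proof
    fix j assume "j \<in> {j. ?g j \<noteq> 0}"
    then have "?g j \<noteq> 0" by (rule CollectD)
    then have "residue_count e s lam j \<noteq> 0" by (rule contrapos_nn) simp
    then show "j \<in> ?A" by blast
  qed
  then have "alpha e s lam = sum ?g ?A"
    unfolding alpha_def by (rule Sum_any.expand_superset[OF fin])
  then have "Poly_Mapping.lookup (alpha e s lam) i = (\<Sum>j\<in>?A. Poly_Mapping.lookup (?g j) i)"
    by (simp only: lookup_sum)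
  also have "\<dots> = (\<Sum>j\<in>?A. if j = i then int (residue_count e s lam i) else 0)"
  proof (rule sum.cong[OF refl])
    fix j
    show "Poly_Mapping.lookup (?g j) i = (if j = i then int (residue_count e s lam i) else 0)"
      using residue_count_outside[of j e s lam] by (cases "j \<in> Zmod e"; cases "j = i") simp_all
  qed
  finally show ?thesis by (simp only: sum.delta[OF fin] insertI1 if_True)
qed

lemma alpha_in_root_lattice: "alpha e s lam \<in> carrier (root_lattice e)"
proof -
  have "i \<in> Zmod e" if "i \<in> Poly_Mapping.keys (alpha e s lam)" for i
    using that residue_count_outside[of i e s lam] 
    by (cases "i \<in> Zmod e") (simp_all add: in_keys_iff lookup_alpha)
  then show ?thesis by (auto simp: root_lattice_def)
qed

lemma finite_weight_support:
  assumes "c \<in> carrier (root_lattice e)"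
  shows "finite {i. (if i \<in> Zmod e
    then (Poly_Mapping.lookup c i - Poly_Mapping.lookup c ((i + 1) mod int e))\<^sup>2 else 0) \<noteq> 0}"
    (is "finite ?S")
proof (cases "e = 0")
  case True
  have "?S \<subseteq> Poly_Mapping.keys c \<union> (\<lambda>i. i - 1) ` Poly_Mapping.keys c"
  proof
    fix i assume i: "i \<in> ?S"
    have "i \<in> Poly_Mapping.keys c \<or> i + 1 \<in> Poly_Mapping.keys c"
    proof (rule ccontr)
      assume "\<not> ?thesis"
      then have "Poly_Mapping.lookup c i = 0" "Poly_Mapping.lookup c ((i + 1) mod int e) = 0"
        by (simp_all add: in_keys_iff True)
      with i show False by (simp split: if_splits)
    qed
    then show "i \<in> Poly_Mapping.keys c \<union> (\<lambda>i. i - 1) ` Poly_Mapping.keys c"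
    proof
      assume "i + 1 \<in> Poly_Mapping.keys c"
      then have "(i + 1) - 1 \<in> (\<lambda>i. i - 1) ` Poly_Mapping.keys c" by (rule imageI)
      then show ?thesis by simp
    qed blast
  qed
  then show ?thesis by (rule finite_subset) simp
next
  case False
  have "?S \<subseteq> {0..<int e}"
  proof
    fix i assume "i \<in> ?S"
    then have "i \<in> Zmod e" by (rule contrapos_pp) simp
    then show "i \<in> {0..<int e}" using False by (simp add: Zmod_pos)
  qed
  then show ?thesis by (rule finite_subset) simp
qed

end

theory Submission
  imports Defs
begin

text \<open>A partition is encoded by its beads, the contents (shifted by \<open>s\<close>) of the last nodes
  of its rows, where infinitely many empty rows are counted as well, each as ending just
  before its first place. The resulting set \<open>B\<close> of integers (its Maya diagram) differs from
  the vacuum \<open>V = {..<s}\<close> in finitely many places. A sum over the nodes of a partition whose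
  terms depend on contents only telescopes along the rows, so it becomes a signed sum
  \<open>excess s B g\<close>, which adds up \<open>g\<close> over \<open>B - V\<close> and subtracts \<open>g\<close> over \<open>V - B\<close>. Three
  choices of \<open>g\<close> matter: the constant \<open>1\<close> gives \<open>0\<close> (\<open>excess_maya_charge\<close>), and this is the
  only restriction on \<open>B\<close> (\<open>maya_surj\<close>); the indicator of the residue class \<open>i\<close> gives the
  difference \<open>d i = c i - c (i + 1)\<close> (\<open>residue_count_diff\<close>); and, for \<open>e > 0\<close>,
  \<open>(k - s) div e\<close> gives \<open>c s\<close> (\<open>residue_count_level\<close>).

  Rim hooks of size \<open>e\<close> correspond to beads \<open>k\<close> for which \<open>k - e\<close> is vacant. So for \<open>e > 0\<close>
  the cores are the partitions for which, on each residue class modulo \<open>e\<close> (a runner of the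
  abacus), the beads form an initial segment. If the runner \<open>i\<close> is filled up to height
  \<open>t i\<close>, then \<open>d i = t i\<close>, the sum of all \<open>t i\<close> is \<open>0\<close>, and \<open>2 * c s\<close> is the sum of all
  \<open>t i * (t i - 1)\<close>, hence of all \<open>(d i)\<^sup>2\<close>: the weight is \<open>0\<close>. Conversely, an element of
  weight \<open>0\<close> is determined by its differences, since these fix the coefficient at \<open>s\<close> and
  then all others (\<open>root_lattice_eqI\<close>); and every family of differences occurs, as the
  runners may be filled to arbitrary heights of sum \<open>0\<close>.

  For \<open>e = 0\<close> there is one runner per integer, with one place only, so a partition has
  \<open>d i \<in> {0, 1}\<close> for \<open>i \<ge> s\<close> and \<open>d i \<in> {0, -1}\<close> for \<open>i < s\<close>. For an arbitrary element of
  weight \<open>0\<close> the same follows from the weight: telescoping turns the equation into the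
  vanishing of the sum of all \<open>d i * (d i - 1)\<close> with \<open>i \<ge> s\<close> and \<open>d i * (d i + 1)\<close> with
  \<open>i < s\<close>, whose terms are nonnegative integers.\<close>

section \<open>Beads and Maya diagrams\<close>

text \<open>Rows are counted from \<open>0\<close> here, as positions of the list are. The row \<open>a\<close> then
  contains the nodes whose contents, shifted by \<open>s\<close>, run from \<open>s - a\<close> to \<open>bead s lam a\<close>.\<close>

definition bead :: "int \<Rightarrow> nat list \<Rightarrow> nat \<Rightarrow> int" where
  "bead s lam a = s + int (lam ! a) - int a - 1"

text \<open>The first part of the union consists of the beads \<open>s - 1 - a\<close> of the empty rows
  \<open>a \<ge> length lam\<close>.\<close>

definition maya :: "int \<Rightarrow> nat list \<Rightarrow> int set" where
  "maya s lam = {..<s - int (length lam)} \<union> bead s lam ` {..<length lam}"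

text \<open>A finite substitute for the difference of the divergent sums of \<open>g\<close> over \<open>B\<close> and over
  \<open>{..<s}\<close>.\<close>

definition excess :: "int \<Rightarrow> int set \<Rightarrow> (int \<Rightarrow> int) \<Rightarrow> int" where
  "excess s B g = sum g (B - {..<s}) - sum g ({..<s} - B)"

lemma bead_strict_decreasing:
  assumes "is_partition lam" "a < b" "b < length lam"
  shows "bead s lam b < bead s lam a"
  using sorted_wrt_nth_less[of "(\<ge>)" lam a b] assms by (simp add: is_partition_def bead_def)

lemma inj_on_bead:
  assumes "is_partition lam"
  shows "inj_on (bead s lam) {..<length lam}"
proof (rule inj_onI)
  fix a b assume "a \<in> {..<length lam}" "b \<in> {..<length lam}" "bead s lam a = bead s lam b"
  then show "a = b"
    using bead_strict_decreasing[OF assms, of a b s] bead_strict_decreasing[OF assms, of b a s]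
    by (cases a b rule: linorder_cases) auto
qed

lemma bead_lower_bound: "a < length lam \<Longrightarrow> s - int (length lam) \<le> bead s lam a"
  by (simp add: bead_def)

lemma sum_diff_sum_eq:
  fixes g :: "'a \<Rightarrow> 'b::ab_group_add"
  assumes "finite X" "finite W"
  shows "sum g X - sum g W = sum g (X - W) - sum g (W - X)"
  using sum.Int_Diff[OF assms(1), of g W] sum.Int_Diff[OF assms(2), of g X]
  by (simp add: Int_commute)

text \<open>Each row contributes the value of \<open>g\<close> at its own bead, and that at the bead of an
  empty row in its place with the opposite sign. Places occupied both by a bead of a row and
  by the vacuum cancel.\<close>

lemma excess_maya:
  assumes "is_partition lam"
  shows "excess s (maya s lam) g = (\<Sum>a<length lam. g (bead s lam a) - g (s - 1 - int a))"
proof -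
  let ?h = "length lam"
  let ?X = "bead s lam ` {..<?h}" and ?W = "{s - int ?h..<s}"
  have "maya s lam - {..<s} = ?X - ?W" "{..<s} - maya s lam = ?W - ?X"
    using bead_lower_bound[of _ lam s] by (force simp: maya_def)+
  then have "excess s (maya s lam) g = sum g ?X - sum g ?W"
    by (simp add: excess_def sum_diff_sum_eq[of ?X ?W])
  also have "sum g ?X = (\<Sum>a<?h. g (bead s lam a))"
    by (simp add: sum.reindex[OF inj_on_bead[OF assms]])
  also have "sum g ?W = (\<Sum>a<?h. g (s - 1 - int a))"
    by (rule sum.reindex_bij_witness[of _ "\<lambda>a. s - 1 - int a" "\<lambda>k. nat (s - 1 - k)"]) auto
  finally show ?thesis by (simp add: sum_subtractf)
qed

lemma finite_maya_diff:
  "finite (maya s lam - {..<s})" "finite ({..<s} - maya s lam)"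
proof -
  have "maya s lam - {..<s} \<subseteq> bead s lam ` {..<length lam}"
    "{..<s} - maya s lam \<subseteq> {s - int (length lam)..<s}"
    by (auto simp: maya_def)
  then show "finite (maya s lam - {..<s})" "finite ({..<s} - maya s lam)"
    using finite_subset by blast+
qed

text \<open>This yields both the height to which a runner of the abacus of a core is filled, and
  the first vacant place of a Maya diagram.\<close>

lemma downclosed_int_initial_segment:
  fixes P :: "int \<Rightarrow> bool"
  assumes down: "\<And>m. P m \<Longrightarrow> P (m - 1)" and "P m0" and bound: "\<And>m. P m \<Longrightarrow> m < N"
  obtains t where "\<And>m. P m \<longleftrightarrow> m < t"
proof -
  define t where "t = Max {m \<in> {m0..N}. P m} + 1"
  have "m0 \<in> {m \<in> {m0..N}. P m}" using assms(2) bound[of m0] by auto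
  moreover have fin: "finite {m \<in> {m0..N}. P m}" by (rule finite_subset[of _ "{m0..N}"]) auto
  ultimately have "t - 1 \<in> {m \<in> {m0..N}. P m}"
    unfolding t_def by (metis (no_types, lifting) Max_in add_diff_cancel_right' empty_iff)
  then have top: "P (t - 1)" and m0: "m0 \<le> t - 1" by auto
  have "P m \<longleftrightarrow> m < t" for m
  proof
    assume "P m"
    show "m < t"
    proof (cases "m0 \<le> m")
      case True
      then have "m \<le> Max {m \<in> {m0..N}. P m}"
        using \<open>P m\<close> bound[of m] fin by (intro Max_ge) auto
      then show ?thesis by (simp add: t_def)
    qed (use m0 in simp)
  next
    assume "m < t"
    then have "m \<le> t - 1" by simp
    then show "P m" by (induction rule: int_le_induct) (use top down in auto)
  qed
  then show ?thesis by (rule that)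
qed

lemma decreasing_list_lower_bound:
  fixes xs :: "int list"
  assumes "sorted_wrt (>) xs" "\<forall>x\<in>set xs. M < x" "a < length xs"
  shows "M + int (length xs) - int a \<le> xs ! a"
  using assms
proof (induction xs arbitrary: a)
  case (Cons x xs)
  show ?case
  proof (cases a)
    case 0
    show ?thesis
    proof (cases xs)
      case (Cons y ys)
      then have "M + int (length xs) \<le> xs ! 0" using Cons.IH[of 0] Cons.prems by simp
      moreover have "xs ! 0 < x" using Cons.prems Cons by simp
      ultimately show ?thesis using 0 by simp
    qed (use Cons.prems 0 in simp)
  next
    case (Suc b)
    then show ?thesis using Cons.IH[of b] Cons.prems by simp
  qed
qed simp

text \<open>Let \<open>M\<close> be the least vacant place. The hypothesis on the excess says that exactly
  \<open>s - M\<close> elements of \<open>B\<close> lie above \<open>M\<close>; listed in decreasing order they are the beads of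
  the nonempty rows. The rows are indeed nonempty because \<open>M\<close> itself is not an element of
  \<open>B\<close>, and their lengths do not increase because the beads decrease strictly.\<close>

lemma maya_surj:
  assumes fin: "finite (B - {..<s})" "finite ({..<s} - B)"
    and charge: "excess s B (\<lambda>_. 1) = 0"
  obtains lam where "is_partition lam" "maya s lam = B"
proof -
  have cards: "card (B - {..<s}) = card ({..<s} - B)" using charge by (simp add: excess_def)
  obtain b where b: "\<And>k. k \<in> {..<s} - B \<Longrightarrow> b \<le> k"
    using bdd_below_finite[OF fin(2)] by (auto simp: bdd_below_def)
  have below: "k \<in> B" if "k < min b s" for k using b[of k] that by force
  obtain u where u: "\<And>k. k \<in> B - {..<s} \<Longrightarrow> k \<le> u"
    using bdd_above_finite[OF fin(1)] by (auto simp: bdd_above_def)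
  obtain M where M: "\<And>m. (\<forall>k\<le>m. k \<in> B) \<longleftrightarrow> m < M"
  proof (rule downclosed_int_initial_segment[of "\<lambda>m. \<forall>k\<le>m. k \<in> B"])
    show "\<forall>k\<le>min b s - 1. k \<in> B" using below by simp
    show "m < max u s + 1" if "\<forall>k\<le>m. k \<in> B" for m
      using u[of m] that by force
  qed auto
  have M_below: "k \<in> B" if "k < M" for k using M[of k] that by blast
  have "M \<notin> B"
  proof
    assume "M \<in> B"
    then have "\<forall>k\<le>M. k \<in> B" using M_below by (metis order_le_less)
    then show False using M by blast
  qed
  have "M \<le> s"
  proof (rule ccontr)
    assume "\<not> M \<le> s"
    then have "s \<in> B - {..<s}" "{..<s} - B = {}" using M_below by auto
    then show False using cards fin(1) by (metis card.empty card_0_eq empty_iff)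
  qed
  let ?X = "B \<inter> {M<..}" and ?W = "{M..<s}"
  have X: "?X = B - {..<M}" using \<open>M \<notin> B\<close> by (auto simp: not_less order_le_less)
  have "?X \<subseteq> (B - {..<s}) \<union> ?W" by auto
  then have finX: "finite ?X" using fin(1) by (auto intro: finite_subset)
  have "?X - ?W = B - {..<s}" "?W - ?X = {..<s} - B"
    using \<open>M \<le> s\<close> M_below unfolding X by (auto simp: not_less) (meson not_less)
  then have "int (card ?X) = s - M"
    using sum_diff_sum_eq[OF finX, of ?W "\<lambda>_. 1::int"] cards \<open>M \<le> s\<close> by simp
  define xs where "xs = rev (sorted_list_of_set ?X)"
  have set_xs: "set xs = ?X" and len: "int (length xs) = s - M"
    using finX \<open>int (card ?X) = s - M\<close> by (simp_all add: xs_def)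
  have dec: "sorted_wrt (>) xs"
    using strict_sorted_list_of_set[of ?X] by (simp add: xs_def sorted_wrt_rev)
  define lam where "lam = map (\<lambda>a. nat (xs ! a - s + int a + 1)) [0..<length xs]"
  have len_lam: "length lam = length xs" by (simp add: lam_def)
  have pos: "xs ! a - s + int a + 1 \<ge> 1" if "a < length xs" for a
    using decreasing_list_lower_bound[OF dec, of M a] that set_xs len by auto
  have "is_partition lam"
    unfolding is_partition_def
  proof
    show "sorted_wrt (\<ge>) lam"
      unfolding sorted_wrt_iff_nth_less
    proof (intro allI impI)
      fix i j assume ij: "i < j" "j < length lam"
      have step: "xs ! b + int b \<le> xs ! a + int a" if "a \<le> b" "b < length xs" for a b
        using that
      proof (induction b rule: dec_induct)
        case (step n)
        moreover have "xs ! Suc n < xs ! n"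
          using sorted_wrt_nth_less[OF dec, of n "Suc n"] step by simp
        ultimately show ?case by simp
      qed simp
      show "lam ! j \<le> lam ! i"
        using ij step[of i j] by (simp add: lam_def nat_mono)
    qed
    show "\<forall>x\<in>set lam. x > 0" using pos by (force simp: lam_def)
  qed
  moreover have "bead s lam a = xs ! a" if "a < length xs" for a
    using pos[OF that] that by (simp add: bead_def lam_def)
  then have "bead s lam ` {..<length lam} = set xs"
    by (force simp: len_lam set_conv_nth)
  then have "maya s lam = B"
    using len M_below unfolding maya_def len_lam set_xs X by auto
  ultimately show ?thesis by (rule that)
qed

section \<open>Residue counts\<close>

lemma residue_count_rows:
  "int (residue_count e s lam i) =
     (\<Sum>a<length lam. \<Sum>k\<in>{s - 1 - int a<..bead s lam a}. of_bool (k mod int e = i))"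
proof -
  let ?Y = "young_diagram lam"
  let ?S = "SIGMA a:{..<length lam}. {s - 1 - int a<..bead s lam a}"
  have "int (residue_count e s lam i) = (\<Sum>x\<in>?Y. of_bool (residue e s x = i))"
    by (simp add: residue_count_def sum_of_bool_eq finite_young_diagram Int_def)
  also have "\<dots> = (\<Sum>(a, k)\<in>?S. of_bool (k mod int e = i))"
    by (rule sum.reindex_bij_witness[of _ "\<lambda>(a, k). (a + 1, nat (k - s + int a + 1))"
          "\<lambda>(a, b). (a - 1, int b - int a + s)"])
      (auto simp: young_diagram_def bead_def residue_def of_nat_diff algebra_simps)
  also have "\<dots> = (\<Sum>a<length lam. \<Sum>k\<in>{s - 1 - int a<..bead s lam a}. of_bool (k mod int e = i))"
    by (simp add: sum.Sigma del: sum_of_bool_eq)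
  finally show ?thesis .
qed

text \<open>Raising the residue by one amounts to shifting the interval of contents of a row down
  by one, so that in the difference only its two ends survive.\<close>

lemma residue_count_diff:
  assumes "is_partition lam" "i \<in> Zmod e"
  shows "int (residue_count e s lam i) - int (residue_count e s lam ((i + 1) mod int e)) =
    excess s (maya s lam) (\<lambda>k. of_bool (k mod int e = i))"
proof -
  let ?P = "\<lambda>k. of_bool (k mod int e = i) :: int"
  have row: "(\<Sum>k\<in>{p<..q}. ?P k) - (\<Sum>k\<in>{p<..q}. of_bool (k mod int e = (i + 1) mod int e)) = ?P q - ?P p"
    if "p \<le> q" for p q
  proof -
    have i: "i mod int e = i" using assms(2) by (auto simp: Zmod_def)
    have shift: "(k + 1) mod int e = (i + 1) mod int e \<longleftrightarrow> k mod int e = i" for k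
    proof -
      have "(k + 1) mod int e = (i + 1) mod int e \<longleftrightarrow> k mod int e = i mod int e"
        by (simp add: mod_eq_dvd_iff)
      then show ?thesis by (simp add: i)
    qed
    have "(\<Sum>k\<in>{p<..q}. of_bool (k mod int e = (i + 1) mod int e)) = (\<Sum>k\<in>{p..<q}. ?P k)"
      by (rule sum.reindex_bij_witness[of _ "\<lambda>k. k + 1" "\<lambda>k. k - 1"])
        (auto simp flip: shift)
    moreover have "{p..q} = insert p {p<..q}" "{p..q} = insert q {p..<q}" using that by auto
    then have "sum ?P (insert p {p<..q}) = sum ?P (insert q {p..<q})" by metis
    then have "?P p + (\<Sum>k\<in>{p<..q}. ?P k) = ?P q + (\<Sum>k\<in>{p..<q}. ?P k)"
      by (simp del: sum_of_bool_eq)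
    ultimately show ?thesis by linarith
  qed
  show ?thesis
    unfolding residue_count_rows excess_maya[OF assms(1)] sum_subtractf[of _ _ "{..<length lam}", symmetric]
    by (intro sum.cong refl row) (simp add: bead_def)
qed

text \<open>A primitive of the indicator of the residue class of \<open>s\<close>. If \<open>e > 0\<close>, it is the height
  of a place on its runner. Division by \<open>e\<close> would give the constant \<open>0\<close> if \<open>e = 0\<close>, where a
  step function takes its place.\<close>

definition level :: "nat \<Rightarrow> int \<Rightarrow> int \<Rightarrow> int" where
  "level e s k = (if e = 0 then of_bool (s \<le> k) else (k - s) div int e)"

lemma level_step: "level e s (k + 1) - level e s k = of_bool ((k + 1) mod int e = s mod int e)"
proof (cases "e = 0")
  case False
  define y r where "y = (k - s) div int e" and "r = (k - s) mod int e"
  have k: "k = s + int e * y + r" and r: "0 \<le> r" "r < int e"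
    using False by (simp_all add: y_def r_def)
  show ?thesis
  proof (cases "r = int e - 1")
    case True
    have "k + 1 - s = int e * (y + 1)" using k True by (simp add: algebra_simps)
    then have "(k + 1 - s) div int e = y + 1" "int e dvd k + 1 - s" using False by simp_all
    then show ?thesis using False by (simp add: level_def y_def mod_eq_dvd_iff)
  next
    case r': False
    have eq: "k + 1 - s = (r + 1) + int e * y" using k by simp
    have "(k + 1 - s) div int e = y" "(k + 1 - s) mod int e = r + 1"
      unfolding eq using r r' False by simp_all
    moreover from this have "\<not> int e dvd k + 1 - s" using r by (simp add: dvd_eq_mod_eq_0)
    ultimately show ?thesis using False by (simp add: level_def y_def mod_eq_dvd_iff)
  qed
qed (auto simp: level_def)

lemma residue_count_level:
  assumes "is_partition lam"
  shows "int (residue_count e s lam (s mod int e)) = excess s (maya s lam) (level e s)"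
proof -
  have row: "(\<Sum>k\<in>{p<..q}. of_bool (k mod int e = s mod int e)) = level e s q - level e s p"
    if "p \<le> q" for p q
    using that
  proof (induction q rule: int_ge_induct)
    case (step q)
    have "{p<..q + 1} = insert (q + 1) {p<..q}" using step by auto
    then show ?case using step level_step[of e s q] by (simp del: sum_of_bool_eq)
  qed simp
  show ?thesis
    unfolding residue_count_rows excess_maya[OF assms]
    by (intro sum.cong refl row) (simp add: bead_def)
qed

section \<open>Rim hooks\<close>

lemma partition_antimono:
  assumes "is_partition lam" "a \<le> b" "b < length lam"
  shows "lam ! b \<le> lam ! a"
  using sorted_wrt_nth_less[of "(\<ge>)" lam a b] assms
  by (cases "a = b") (simp_all add: is_partition_def)

lemma young_diagram_down:
  assumes "is_partition lam" "(a, b) \<in> young_diagram lam" "1 \<le> a'" "a' \<le> a" "1 \<le> b'" "b' \<le> b"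
  shows "(a', b') \<in> young_diagram lam"
proof -
  have "lam ! (a - 1) \<le> lam ! (a' - 1)"
    using assms by (intro partition_antimono) (auto simp: young_diagram_def)
  then show ?thesis using assms by (auto simp: young_diagram_def)
qed

text \<open>Subtracting row from column numbers maps the rim hook bijectively onto the interval
  between the contents of its two ends, the bottom \<open>(l, b)\<close> of the column and the end of the
  row \<open>a\<close>. Injectivity: of two nodes on one diagonal, the upper one has a diagonal successor
  in the diagram. Surjectivity: on every diagonal in question there is a node weakly below
  and to the right of \<open>(a, b)\<close>, and the last such node lies on the rim.\<close>

lemma card_rim_hook:
  assumes part: "is_partition lam" and ab: "(a, b) \<in> young_diagram lam"
    and l: "(l, b) \<in> young_diagram lam" "(l + 1, b) \<notin> young_diagram lam"
  shows "int (card (rim_hook lam (a, b))) = int (lam ! (a - 1)) - int a + int l - int b + 1"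
proof -
  let ?Y = "young_diagram lam"
  let ?c = "\<lambda>(x, y). int y - int x"
  let ?I = "{int b - int l..int (lam ! (a - 1)) - int a}"
  have pos: "1 \<le> a" "1 \<le> b" "1 \<le> l" "b \<le> lam ! (a - 1)" using ab l by (auto simp: young_diagram_def)
  have al: "a \<le> l"
  proof (rule ccontr)
    assume "\<not> a \<le> l"
    then have "(l + 1, b) \<in> ?Y" using young_diagram_down[OF part ab, of "l + 1" b] pos by simp
    with l(2) show False by simp
  qed
  have "bij_betw ?c (rim_hook lam (a, b)) ?I"
    unfolding bij_betw_def
  proof
    have no_step: False if "(x, y) \<in> rim_hook lam (a, b)" "(x + k, y + k) \<in> ?Y" "k \<ge> 1" for x y k
      using young_diagram_down[OF part that(2), of "x + 1" "y + 1"] that by (simp add: rim_hook_def)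
    show "inj_on ?c (rim_hook lam (a, b))"
    proof (rule inj_onI, clarify)
      fix x y x' y'
      assume xy: "(x, y) \<in> rim_hook lam (a, b)" "(x', y') \<in> rim_hook lam (a, b)"
        and c: "int y - int x = int y' - int x'"
      then have Y: "(x, y) \<in> ?Y" "(x', y') \<in> ?Y" by (auto simp: rim_hook_def)
      consider "x < x'" | "x' < x" | "x = x'" by linarith
      then show "x = x' \<and> y = y'"
      proof cases
        case 1
        define k where "k = x' - x"
        have "x' = x + k" "y' = y + k" "k \<ge> 1" using c 1 unfolding k_def by linarith+
        then show ?thesis using no_step[OF xy(1), of k] Y by simp
      next
        case 2
        define k where "k = x - x'"
        have "x = x' + k" "y = y' + k" "k \<ge> 1" using c 2 unfolding k_def by linarith+
        then show ?thesis using no_step[OF xy(2), of k] Y by simp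
      qed (use c in simp)
    qed
    show "?c ` rim_hook lam (a, b) = ?I"
    proof (intro equalityI subsetI)
      fix c assume "c \<in> ?c ` rim_hook lam (a, b)"
      then obtain x y where xy: "(x, y) \<in> ?Y" "a \<le> x" "b \<le> y" and c: "c = int y - int x"
        by (auto simp: rim_hook_def)
      have "x \<le> l"
      proof (rule ccontr)
        assume "\<not> x \<le> l"
        then have "(l + 1, b) \<in> ?Y" using young_diagram_down[OF part xy(1), of "l + 1" b] pos xy by simp
        with l(2) show False by simp
      qed
      moreover have "(a, y) \<in> ?Y" using young_diagram_down[OF part xy(1), of a y] pos xy by simp
      then have "y \<le> lam ! (a - 1)" by (simp add: young_diagram_def)
      ultimately show "c \<in> ?I" using xy c by simp
    next
      fix c assume c: "c \<in> ?I"
      \<comment> \<open>The diagonal meets the hook of \<open>(a, b)\<close>: in its arm or in its leg.\<close>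
      obtain x y where xy: "(x, y) \<in> ?Y" "a \<le> x" "b \<le> y" and cxy: "int y - int x = c"
      proof (cases "int b - int a \<le> c")
        case True
        show ?thesis
          by (rule that[of a "nat (int a + c)"]) (use True c ab pos in \<open>auto simp: young_diagram_def\<close>)
      next
        case False
        have "(nat (int b - c), b) \<in> ?Y"
          using young_diagram_down[OF part l(1), of "nat (int b - c)" b] False c pos by auto
        then show ?thesis using that[of "nat (int b - c)" b] False by simp
      qed
      define k where "k = Max {k. (x + k, y + k) \<in> ?Y}"
      have "{k. (x + k, y + k) \<in> ?Y} \<subseteq> {..length lam}" by (auto simp: young_diagram_def)
      then have fin: "finite {k. (x + k, y + k) \<in> ?Y}" by (rule finite_subset) simp
      moreover have "0 \<in> {k. (x + k, y + k) \<in> ?Y}" using xy by simp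
      ultimately have "(x + k, y + k) \<in> ?Y" using Max_in[OF fin] unfolding k_def by blast
      moreover have "(x + k + 1, y + k + 1) \<notin> ?Y"
      proof
        assume "(x + k + 1, y + k + 1) \<in> ?Y"
        then have "Suc k \<le> k" using Max_ge[OF fin, of "Suc k"] by (simp add: k_def)
        then show False by simp
      qed
      ultimately have "(x + k, y + k) \<in> rim_hook lam (a, b)" using xy by (simp add: rim_hook_def)
      then show "c \<in> ?c ` rim_hook lam (a, b)" using cxy by force
    qed
  qed
  then have "card (rim_hook lam (a, b)) = card ?I" by (rule bij_betw_same_card)
  then show ?thesis using pos al by simp
qed

lemma column_bottom:
  assumes "(a, b) \<in> young_diagram lam"
  obtains l where "a \<le> l" "(l, b) \<in> young_diagram lam" "(l + 1, b) \<notin> young_diagram lam"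
proof -
  let ?C = "{a. (a, b) \<in> young_diagram lam}"
  have "?C \<subseteq> {..length lam}" by (auto simp: young_diagram_def)
  then have fin: "finite ?C" by (rule finite_subset) simp
  have "Max ?C \<in> ?C" using Max_in[OF fin] assms by blast
  moreover have "a \<le> Max ?C" using Max_ge[OF fin] assms by simp
  moreover have "Max ?C + 1 \<notin> ?C" using Max_ge[OF fin, of "Max ?C + 1"] by linarith
  ultimately show ?thesis using that by simp
qed

lemma is_core_0_iff: "is_core 0 lam \<longleftrightarrow> is_partition lam"
proof -
  have "card (rim_hook lam x) \<noteq> 0" if "is_partition lam" "x \<in> young_diagram lam" for x
  proof -
    have "x \<in> young_diagram lam" by fact
    then obtain a b where x: "x = (a, b)" and ab: "(a, b) \<in> young_diagram lam" by (cases x) simp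
    obtain l where "a \<le> l" "(l, b) \<in> young_diagram lam" "(l + 1, b) \<notin> young_diagram lam"
      using column_bottom[OF ab] .
    then show ?thesis
      using card_rim_hook[OF that(1) ab, of l] ab x by (auto simp: young_diagram_def)
  qed
  then show ?thesis by (auto simp: is_core_def)
qed

text \<open>Suppose that the place \<open>g = k - e\<close> below the bead \<open>k\<close> of a row \<open>a\<close> is vacant. Let \<open>l\<close>
  be the last row whose bead lies above \<open>g\<close>. The column \<open>b\<close> whose bottom node is in row \<open>l\<close>
  and has shifted content \<open>g + 1\<close> then ends there, and the rim hook of the node in row \<open>a\<close>
  and column \<open>b\<close> has size \<open>k - g = e\<close>.\<close>

lemma maya_closed_if_core:
  assumes core: "is_core e lam" and k: "k \<in> maya s lam"
  shows "k - int e \<in> maya s lam"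
proof (rule ccontr)
  let ?h = "length lam"
  define g where "g = k - int e"
  assume "k - int e \<notin> maya s lam"
  then have g: "g \<notin> maya s lam" by (simp add: g_def)
  have part: "is_partition lam" using core by (simp add: is_core_def)
  have gh: "s - int ?h \<le> g" using g by (auto simp: maya_def)
  then obtain a where a: "a < ?h" "k = bead s lam a" using k by (auto simp: maya_def g_def)
  have ga: "g < bead s lam a"
    using g k a by (cases "e = 0") (auto simp: g_def)
  let ?R = "{a. a < ?h \<and> g < bead s lam a}"
  define l where "l = Max ?R"
  have fin: "finite ?R" by simp
  have "l \<in> ?R" unfolding l_def using Max_in[OF fin] a ga by blast
  have "a \<le> l" unfolding l_def using Max_ge[OF fin] a ga by simp
  have next_row: "bead s lam (l + 1) < g" if "l + 1 < ?h"
  proof -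
    have "l + 1 \<notin> ?R"
    proof
      assume "l + 1 \<in> ?R"
      then have "l + 1 \<le> l" unfolding l_def by (rule Max_ge[OF fin])
      then show False by simp
    qed
    moreover have "bead s lam (l + 1) \<noteq> g" using g that by (auto simp: maya_def)
    ultimately show ?thesis using that by simp
  qed
  \<comment> \<open>The rows \<open>a\<close> and \<open>l\<close> count from \<open>0\<close>, the column \<open>b\<close> from \<open>1\<close>: the node \<open>(l + 1, b)\<close> has content \<open>g + 1 - s\<close>.\<close>
  define b where "b = nat (g + int l + 2 - s)"
  have b: "int b = g + int l + 2 - s" "1 \<le> b"
  proof -
    have "g + int l + 2 - s \<ge> 1"
    proof (cases "l + 1 < ?h")
      case True
      then show ?thesis using next_row by (simp add: bead_def)
    next
      case False
      then show ?thesis using gh by simp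
    qed
    then show "int b = g + int l + 2 - s" "1 \<le> b" by (auto simp: b_def)
  qed
  have lY: "(l + 1, b) \<in> young_diagram lam"
    using \<open>l \<in> ?R\<close> b by (auto simp: young_diagram_def bead_def)
  have lY': "(l + 1 + 1, b) \<notin> young_diagram lam"
    using next_row b by (auto simp: young_diagram_def bead_def)
  have aY: "(a + 1, b) \<in> young_diagram lam"
    using young_diagram_down[OF part lY, of "a + 1" b] \<open>a \<le> l\<close> b by simp
  have "int (card (rim_hook lam (a + 1, b))) = int e"
    using card_rim_hook[OF part aY lY lY'] b a by (simp add: g_def bead_def)
  then show False using core aY by (auto simp: is_core_def)
qed

text \<open>Removing a rim hook of size \<open>e\<close> that belongs to a node in column \<open>b\<close> moves a bead down
  by \<open>e\<close> to the place \<open>s + b - l - 1\<close>, where \<open>l\<close> is the length of the column. No bead was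
  there: the rows that meet the column have their beads above this place, and all others
  below.\<close>

lemma core_if_maya_closed:
  assumes part: "is_partition lam" and closed: "\<And>k. k \<in> maya s lam \<Longrightarrow> k - int e \<in> maya s lam"
  shows "is_core e lam"
  unfolding is_core_def
proof (intro conjI notI part)
  assume "\<exists>x\<in>young_diagram lam. card (rim_hook lam x) = e"
  then obtain a b where ab: "(a, b) \<in> young_diagram lam" and e: "card (rim_hook lam (a, b)) = e"
    by auto
  obtain l where l: "a \<le> l" "(l, b) \<in> young_diagram lam" "(l + 1, b) \<notin> young_diagram lam"
    using column_bottom[OF ab] .
  have pos: "1 \<le> a" "a \<le> length lam" "1 \<le> b" "l \<le> length lam"
    using ab l by (auto simp: young_diagram_def)
  have "bead s lam (a - 1) \<in> maya s lam" using pos by (auto simp: maya_def)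
  then have "bead s lam (a - 1) - int e \<in> maya s lam" by (rule closed)
  moreover have "bead s lam (a - 1) - int e = s + int b - int l - 1"
    using card_rim_hook[OF part ab l(2,3)] e pos by (simp add: bead_def of_nat_diff)
  ultimately have "s + int b - int l - 1 \<in> maya s lam" by simp
  then obtain r where r: "r < length lam" "s + int b - int l - 1 = bead s lam r"
    using pos by (auto simp: maya_def)
  show False
  proof (cases "r < l")
    case True
    then have "(r + 1, b) \<in> young_diagram lam"
      using young_diagram_down[OF part l(2), of "r + 1" b] pos by simp
    then show False using r True by (simp add: young_diagram_def bead_def)
  next
    case False
    then have "(r + 1, b) \<notin> young_diagram lam"
      using young_diagram_down[OF part, of "r + 1" b "l + 1" b] l(3) pos by auto
    then show False using r False pos by (auto simp: young_diagram_def bead_def)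
  qed
qed

section \<open>Abacus configurations\<close>

text \<open>The runner of residue \<open>i\<close> is filled exactly below height \<open>t i\<close>. For \<open>e > 0\<close> the vacuum
  \<open>{..<s}\<close> is the case \<open>t = (\<lambda>_. 0)\<close>.\<close>

definition abacus :: "nat \<Rightarrow> int \<Rightarrow> (int \<Rightarrow> int) \<Rightarrow> int set" where
  "abacus e s t = {k. (k - s) div int e < t (k mod int e)}"

text \<open>The summand \<open>(i - s) mod e\<close> puts height \<open>0\<close> at the first place of residue \<open>i\<close> that is
  not below \<open>s\<close>, in agreement with the heights \<open>(k - s) div e\<close>.\<close>

definition position :: "nat \<Rightarrow> int \<Rightarrow> int \<Rightarrow> int \<Rightarrow> int" where
  "position e s i m = s + (i - s) mod int e + int e * m"

lemma position_mod: "i mod int e = i \<Longrightarrow> position e s i m mod int e = i"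
  by (simp add: position_def mod_simps)

lemma position_div: "e > 0 \<Longrightarrow> (position e s i m - s) div int e = m"
  by (simp add: position_def)

lemma position_eq: "position e s (k mod int e) ((k - s) div int e) = k"
proof -
  have "(k mod int e - s) mod int e = (k - s) mod int e" by (simp add: mod_simps)
  then show ?thesis by (simp add: position_def)
qed

lemma excess_abacus:
  assumes e: "e > 0"
  shows "excess s (abacus e s t) g =
    (\<Sum>i\<in>Zmod e. (\<Sum>m\<in>{0..<t i}. g (position e s i m)) - (\<Sum>m\<in>{t i..<0}. g (position e s i m)))"
    and "finite (abacus e s t - {..<s})" and "finite ({..<s} - abacus e s t)"
proof -
  let ?p = "\<lambda>(i, m). position e s i m" and ?q = "\<lambda>k. (k mod int e, (k - s) div int e)"
  have bij: "bij_betw ?p (SIGMA i:Zmod e. S i) {k. (k - s) div int e \<in> S (k mod int e)}"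
    for S :: "int \<Rightarrow> int set"
    by (rule bij_betw_byWitness[where f' = ?q])
      (use e in \<open>auto simp: position_mod position_div position_eq Zmod_def\<close>)
  have neg: "k < s \<longleftrightarrow> (k - s) div int e < 0" for k
    using pos_imp_zdiv_neg_iff[of "int e" "k - s"] e by simp
  have A: "abacus e s t - {..<s} = {k. (k - s) div int e \<in> {0..<t (k mod int e)}}"
    "{..<s} - abacus e s t = {k. (k - s) div int e \<in> {t (k mod int e)..<0}}"
    by (auto simp: abacus_def neg)
  have fin: "finite (Zmod e)" using e by (simp add: Zmod_pos)
  have S: "sum g {k. (k - s) div int e \<in> S (k mod int e)} = (\<Sum>i\<in>Zmod e. \<Sum>m\<in>S i. g (position e s i m))"
    if "\<And>i. finite (S i)" for S
    using sum.reindex_bij_betw[OF bij, of g S] fin that by (simp add: sum.Sigma case_prod_unfold)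
  show "excess s (abacus e s t) g =
    (\<Sum>i\<in>Zmod e. (\<Sum>m\<in>{0..<t i}. g (position e s i m)) - (\<Sum>m\<in>{t i..<0}. g (position e s i m)))"
    unfolding excess_def A using S[of "\<lambda>i. {0..<t i}"] S[of "\<lambda>i. {t i..<0}"]
    by (simp add: sum_subtractf)
  have "finite (SIGMA i:Zmod e. {0..<t i})" "finite (SIGMA i:Zmod e. {t i..<0})"
    using fin by auto
  then show "finite (abacus e s t - {..<s})" "finite ({..<s} - abacus e s t)"
    unfolding A by (simp_all only: bij_betw_finite[OF bij])
qed

text \<open>The sum of the heights of the beads on a runner that is filled to height \<open>t\<close>, relative
  to the vacuum.\<close>

lemma sum_signed_interval:
  fixes t :: int
  shows "2 * (\<Sum>{0..<t} - \<Sum>{t..<0}) = t\<^sup>2 - t"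
proof (cases "0 \<le> t")
  case True
  have "2 * \<Sum>{0..<t} = t\<^sup>2 - t" using True
  proof (induction t rule: int_ge_induct)
    case (step t)
    have "{0..<t + 1} = insert t {0..<t}" using step by auto
    then show ?case using step by (simp add: power2_eq_square algebra_simps)
  qed simp
  then show ?thesis using True by simp
next
  case False
  then have "t \<le> 0" by simp
  then have "- 2 * \<Sum>{t..<0} = t\<^sup>2 - t"
  proof (induction t rule: int_le_induct)
    case (step t)
    have "{t - 1..<0} = insert (t - 1) {t..<0}" using step by auto
    then show ?case using step by (simp add: power2_eq_square algebra_simps)
  qed simp
  then show ?thesis using False by simp
qed

text \<open>On each runner only an interval of heights between \<open>0\<close> and \<open>t i\<close> contributes, counted
  with the sign of \<open>t i\<close>.\<close>

lemma excess_abacus_values: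
  assumes e: "e > 0"
  shows excess_abacus_charge: "excess s (abacus e s t) (\<lambda>_. 1) = (\<Sum>i\<in>Zmod e. t i)"
    and excess_abacus_residue:
      "i \<in> Zmod e \<Longrightarrow> excess s (abacus e s t) (\<lambda>k. of_bool (k mod int e = i)) = t i"
    and excess_abacus_level:
      "2 * excess s (abacus e s t) (level e s) = (\<Sum>i\<in>Zmod e. (t i)\<^sup>2 - t i)"
proof -
  show "excess s (abacus e s t) (\<lambda>_. 1) = (\<Sum>i\<in>Zmod e. t i)"
    unfolding excess_abacus[OF e] by (intro sum.cong) auto
  have mod: "j mod int e = j" if "j \<in> Zmod e" for j using that by (auto simp: Zmod_def)
  show "excess s (abacus e s t) (\<lambda>k. of_bool (k mod int e = i)) = t i" if i: "i \<in> Zmod e"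
  proof -
    have "excess s (abacus e s t) (\<lambda>k. of_bool (k mod int e = i)) =
      (\<Sum>j\<in>Zmod e. if j = i then t i else 0)"
      unfolding excess_abacus[OF e] by (intro sum.cong) (auto simp: position_mod mod)
    then show ?thesis using i e by (simp add: Zmod_pos)
  qed
  have "2 * excess s (abacus e s t) (level e s) =
    (\<Sum>i\<in>Zmod e. 2 * (\<Sum>{0..<t i} - \<Sum>{t i..<0}))"
    unfolding excess_abacus[OF e] using e by (simp add: level_def position_div sum_distrib_left)
  then show "2 * excess s (abacus e s t) (level e s) = (\<Sum>i\<in>Zmod e. (t i)\<^sup>2 - t i)"
    by (simp only: sum_signed_interval)
qed

text \<open>A core has a Maya diagram closed under subtraction of \<open>e\<close>, hence downward closed on
  every runner.\<close>

lemma maya_core_eq_abacus: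
  assumes core: "is_core e lam" and e: "e > 0"
  obtains t where "maya s lam = abacus e s t"
proof -
  let ?B = "maya s lam"
  have "bdd_above (insert s ?B)"
  proof -
    have "?B \<subseteq> {..<s} \<union> (?B - {..<s})" by blast
    then show ?thesis using finite_maya_diff(1)[of s lam]
      by (meson bdd_above_Iio bdd_above_Un bdd_above_finite bdd_above_insert bdd_above_mono)
  qed
  then obtain u where u: "\<And>k. k \<in> ?B \<Longrightarrow> k \<le> u" and su: "s \<le> u" by (auto simp: bdd_above_def)
  have "\<exists>t. \<forall>m. position e s i m \<in> ?B \<longleftrightarrow> m < t" for i
  proof -
    have pos: "s + int e * m \<le> position e s i m" "position e s i m < s + int e * (m + 1)" for m
      using e by (simp_all add: position_def algebra_simps)
    obtain t where "\<And>m. position e s i m \<in> ?B \<longleftrightarrow> m < t"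
    proof (rule downclosed_int_initial_segment[of "\<lambda>m. position e s i m \<in> ?B"])
      show "position e s i (m - 1) \<in> ?B" if "position e s i m \<in> ?B" for m
        using maya_closed_if_core[OF core that] by (simp add: position_def algebra_simps)
      have "int e * (- int (length lam)) \<le> 1 * (- int (length lam))"
        using e by (intro mult_right_mono_neg) auto
      then have "position e s i (- int (length lam) - 1) < s - int (length lam)"
        using pos(2)[of "- int (length lam) - 1"] by simp
      then show "position e s i (- int (length lam) - 1) \<in> ?B" by (simp add: maya_def)
      show "m < u - s + 1" if "position e s i m \<in> ?B" for m
      proof (cases "m \<le> 0")
        case False
        then have "1 * m \<le> int e * m" using e by (intro mult_right_mono) auto
        then show ?thesis using pos(1)[of m] u[OF that] by simp
      qed (use su in simp)
    qed auto
    then show ?thesis by blast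
  qed
  then obtain t where t: "\<And>i m. position e s i m \<in> ?B \<longleftrightarrow> m < t i" by metis
  have "k \<in> ?B \<longleftrightarrow> k \<in> abacus e s t" for k
    using t[of "k mod int e" "(k - s) div int e"] by (simp add: position_eq abacus_def)
  then show ?thesis using that by blast
qed

section \<open>Elements of weight zero\<close>

definition coeff_diff :: "nat \<Rightarrow> (int \<Rightarrow>\<^sub>0 int) \<Rightarrow> int \<Rightarrow> int" where
  "coeff_diff e c i = Poly_Mapping.lookup c i - Poly_Mapping.lookup c ((i + 1) mod int e)"

lemma weight_eq_0_iff:
  "weight e s c = 0 \<longleftrightarrow> 2 * Poly_Mapping.lookup c (s mod int e) =
     Sum_any (\<lambda>i. if i \<in> Zmod e then (coeff_diff e c i)\<^sup>2 else 0)"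
proof -
  let ?S = "Sum_any (\<lambda>i. if i \<in> Zmod e then (coeff_diff e c i)\<^sup>2 else 0)"
  have "weight e s c = 0 \<longleftrightarrow> rat_of_int (2 * Poly_Mapping.lookup c (s mod int e)) = rat_of_int ?S"
    unfolding weight_def coeff_diff_def by (simp add: field_simps)
  then show ?thesis by (simp only: of_int_eq_iff)
qed

text \<open>The differences together with the vanishing of the weight determine the coefficient at
  \<open>s\<close>, from which the differences lead to all the others, one step at a time.\<close>

lemma root_lattice_eqI:
  assumes "c \<in> carrier (root_lattice e)" "c' \<in> carrier (root_lattice e)"
    and weight: "weight e s c = 0" "weight e s c' = 0"
    and diff: "\<And>i. i \<in> Zmod e \<Longrightarrow> coeff_diff e c i = coeff_diff e c' i"
  shows "c = c'"
proof -
  let ?l = "Poly_Mapping.lookup"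
  have base: "?l c (s mod int e) = ?l c' (s mod int e)"
    using weight diff unfolding weight_eq_0_iff by (simp cong: if_cong)
  have step: "?l c (k mod int e) - ?l c ((k + 1) mod int e) =
      ?l c' (k mod int e) - ?l c' ((k + 1) mod int e)" for k
    using diff[of "k mod int e"] by (simp add: coeff_diff_def Zmod_def mod_simps)
  have all: "?l c (k mod int e) = ?l c' (k mod int e)" for k
  proof (induction k rule: int_induct[where k = s])
    case (step1 k)
    then show ?case using step[of k] by simp
  next
    case (step2 k)
    then show ?case using step[of "k - 1"] by simp
  qed (rule base)
  show ?thesis
  proof (rule poly_mapping_eqI)
    fix i
    show "?l c i = ?l c' i"
    proof (cases "i \<in> Zmod e")
      case True
      then show ?thesis using all[of i] by (auto simp: Zmod_def)
    next
      case False
      then have "i \<notin> Poly_Mapping.keys c" "i \<notin> Poly_Mapping.keys c'"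
        using assms(1,2) by (auto simp: root_lattice_def)
      then show ?thesis by (simp add: in_keys_iff)
    qed
  qed
qed

lemma coeff_diff_alpha:
  assumes "is_partition lam" "i \<in> Zmod e"
  shows "coeff_diff e (alpha e s lam) i = excess s (maya s lam) (\<lambda>k. of_bool (k mod int e = i))"
  using residue_count_diff[OF assms] by (simp add: coeff_diff_def lookup_alpha)

lemma excess_maya_charge: "is_partition lam \<Longrightarrow> excess s (maya s lam) (\<lambda>_. 1) = 0"
  by (simp add: excess_maya)

lemma excess_singleton:
  assumes "finite (B - {..<s})" "finite ({..<s} - B)"
  shows "excess s B (\<lambda>k. of_bool (k = i)) = of_bool (i \<in> B - {..<s}) - of_bool (i \<in> {..<s} - B)"
proof -
  have "(\<Sum>k\<in>A. of_bool (k = i)) = (of_bool (i \<in> A) :: int)" if "finite A" for A :: "int set"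
    using that by (simp add: of_bool_def)
  then show ?thesis using assms by (simp only: excess_def)
qed

text \<open>For \<open>e > 0\<close> the level sum over the abacus is half the sum of \<open>(t i)\<^sup>2 - t i\<close>, and the
  linear terms cancel as the charge is \<open>0\<close>. For \<open>e = 0\<close> the squared differences count the
  places where the Maya diagram and the vacuum disagree; one half of these are beads at or
  above \<open>s\<close>, whose number is the coefficient at \<open>s\<close>.\<close>

lemma weight_alpha_core:
  assumes core: "is_core e lam"
  shows "weight e s (alpha e s lam) = 0"
proof -
  let ?B = "maya s lam"
  have part: "is_partition lam" using core by (simp add: is_core_def)
  have coeff: "Poly_Mapping.lookup (alpha e s lam) (s mod int e) = excess s ?B (level e s)"
    by (simp add: lookup_alpha residue_count_level[OF part])
  show ?thesis
  proof (cases "e = 0")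
    case False
    then have e: "e > 0" by simp
    obtain t where t: "?B = abacus e s t" using maya_core_eq_abacus[OF core e] .
    have diff: "coeff_diff e (alpha e s lam) i = t i" if "i \<in> Zmod e" for i
      using coeff_diff_alpha[OF part that, of s] excess_abacus_residue[OF e that] t by simp
    have "(\<Sum>i\<in>Zmod e. t i) = 0"
      using excess_maya_charge[OF part, of s] excess_abacus_charge[OF e, of s t] t by simp
    then have "2 * excess s ?B (level e s) = (\<Sum>i\<in>Zmod e. (t i)\<^sup>2)"
      unfolding t excess_abacus_level[OF e] by (simp add: sum_subtractf)
    also have "\<dots> = (\<Sum>i\<in>Zmod e. (coeff_diff e (alpha e s lam) i)\<^sup>2)"
      by (simp add: diff)
    also have "\<dots> = Sum_any (\<lambda>i. if i \<in> Zmod e then (coeff_diff e (alpha e s lam) i)\<^sup>2 else 0)"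
      by (rule Sum_any.conditionalize) (use e in \<open>simp add: Zmod_pos\<close>)
    finally show ?thesis by (simp only: weight_eq_0_iff coeff)
  next
    case True
    let ?P = "?B - {..<s}" and ?N = "{..<s} - ?B"
    have "coeff_diff e (alpha e s lam) i = of_bool (i \<in> ?P) - of_bool (i \<in> ?N)" for i
      using coeff_diff_alpha[OF part, of i e s] excess_singleton[OF finite_maya_diff, of s lam i] True
      by (simp add: Zmod_0)
    then have "Sum_any (\<lambda>i. if i \<in> Zmod e then (coeff_diff e (alpha e s lam) i)\<^sup>2 else 0) =
        Sum_any (\<lambda>i. if i \<in> ?P \<union> ?N then 1 else 0)"
      by (intro Sum_any.cong) (auto simp: True Zmod_0)
    also have "\<dots> = (\<Sum>i\<in>?P \<union> ?N. 1)"
      by (rule Sum_any.conditionalize[symmetric]) (simp add: finite_maya_diff)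
    also have "\<dots> = int (card ?P) + int (card ?N)"
      using card_Un_disjoint[OF finite_maya_diff, of s lam] by fastforce
    also have "int (card ?N) = int (card ?P)"
      using excess_maya_charge[OF part, of s] by (simp add: excess_def)
    also have "excess s ?B (level e s) = int (card ?P)"
      by (simp add: excess_def level_def True)
    then have "int (card ?P) + int (card ?P) = 2 * excess s ?B (level e s)" by simp
    finally show ?thesis by (simp only: weight_eq_0_iff coeff)
  qed
qed

text \<open>The differences sum to \<open>0\<close> around the cycle of residues, so the abacus with these
  heights has charge \<open>0\<close> and therefore comes from a partition. It is closed under
  subtraction of \<open>e\<close> by construction.\<close>

lemma core_with_coeff_diff_pos:
  assumes e: "e > 0"
  obtains lam where "is_core e lam" "\<And>i. i \<in> Zmod e \<Longrightarrow> coeff_diff e (alpha e s lam) i = coeff_diff e c i"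
proof -
  let ?t = "coeff_diff e c"
  have "(\<Sum>i\<in>Zmod e. Poly_Mapping.lookup c ((i + 1) mod int e)) = (\<Sum>i\<in>Zmod e. Poly_Mapping.lookup c i)"
    by (rule sum.reindex_bij_witness[of _ "\<lambda>i. (i - 1) mod int e" "\<lambda>i. (i + 1) mod int e"])
      (auto simp: Zmod_def mod_simps)
  then have "(\<Sum>i\<in>Zmod e. ?t i) = 0" by (simp add: coeff_diff_def sum_subtractf)
  then have "excess s (abacus e s ?t) (\<lambda>_. 1) = 0" by (simp add: excess_abacus_charge[OF e])
  then obtain lam where part: "is_partition lam" and maya: "maya s lam = abacus e s ?t"
    using maya_surj[OF excess_abacus(2,3)[OF e]] by blast
  have "k - int e \<in> maya s lam" if "k \<in> maya s lam" for k
  proof -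
    have "(k - int e - s) div int e = (k - s) div int e - 1"
      using e div_add_self1[of "int e" "k - int e - s"] by (simp add: algebra_simps)
    moreover have "(k - int e) mod int e = k mod int e" by simp
    ultimately show ?thesis using that by (simp add: maya abacus_def)
  qed
  then have "is_core e lam" by (rule core_if_maya_closed[OF part])
  moreover have "coeff_diff e (alpha e s lam) i = ?t i" if "i \<in> Zmod e" for i
    using coeff_diff_alpha[OF part that, of s] excess_abacus_residue[OF e that] by (simp add: maya)
  ultimately show ?thesis by (rule that)
qed

text \<open>The differences sum to \<open>c s\<close> over the indices from \<open>s\<close> on and to \<open>- c s\<close> over those
  below, so weight \<open>0\<close> means that the sum of \<open>(d i)\<^sup>2 - d i\<close> over the former and of
  \<open>(d i)\<^sup>2 + d i\<close> over the latter indices vanishes. No term is negative, so the differences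
  are those of a set \<open>B\<close>: they are \<open>1\<close> at the elements of \<open>B\<close> from \<open>s\<close> on, \<open>-1\<close> at the gaps
  below \<open>s\<close>, and \<open>0\<close> elsewhere.\<close>

lemma core_with_coeff_diff_0:
  assumes weight: "weight 0 s c = 0"
  obtains lam where "is_core 0 lam" "\<And>i. coeff_diff 0 (alpha 0 s lam) i = coeff_diff 0 c i"
proof -
  let ?l = "Poly_Mapping.lookup c"
  let ?d = "coeff_diff 0 c"
  have d: "?d i = ?l i - ?l (i + 1)" for i by (simp add: coeff_diff_def)
  let ?K = "insert s (Poly_Mapping.keys c)"
  \<comment> \<open>Outside the open interval from \<open>p\<close> to \<open>q\<close> all coefficients vanish, and \<open>s\<close> lies inside.\<close>
  define p q where "p = Min ?K - 1" and "q = Max ?K + 1"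
  have pq: "p < i \<and> i < q" if "i \<in> ?K" for i
  proof -
    have "Min ?K \<le> i" "i \<le> Max ?K" by (rule Min_le Max_ge; use that in simp)+
    then show ?thesis unfolding p_def q_def by linarith
  qed
  have out: "?l i = 0" if "i \<le> p \<or> q \<le> i" for i
  proof (rule ccontr)
    assume "?l i \<noteq> 0"
    then have "i \<in> ?K" by (simp add: in_keys_iff)
    then show False using pq[of i] that by linarith
  qed
  have ps: "p < s" "s < q" using pq[of s] by auto
  have out_d: "?d i = 0" if "i < p \<or> q \<le> i" for i using that out[of i] out[of "i + 1"] by (auto simp: d)
  have tele: "sum ?d {a..<b} = ?l a - ?l b" if "a \<le> b" for a b
    using that
  proof (induction b rule: int_ge_induct)
    case (step b)
    have "{a..<b + 1} = insert b {a..<b}" using step by auto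
    then show ?case using step by (simp add: d)
  qed simp
  have upper: "sum ?d {s..<q} = ?l s" and lower: "sum ?d {p..<s} = - ?l s"
    using tele[of s q] tele[of p s] ps out[of p] out[of q] by auto
  have split: "{p..<q} = {p..<s} \<union> {s..<q}" using ps by auto
  have "2 * ?l s = Sum_any (\<lambda>i. (?d i)\<^sup>2)"
    using weight by (simp add: weight_eq_0_iff Zmod_0)
  also have "\<dots> = (\<Sum>i\<in>{p..<q}. (?d i)\<^sup>2)"
  proof (rule Sum_any.expand_superset)
    show "{i. (?d i)\<^sup>2 \<noteq> 0} \<subseteq> {p..<q}"
    proof
      fix i assume "i \<in> {i. (?d i)\<^sup>2 \<noteq> 0}"
      then have "?d i \<noteq> 0" by simp
      then have "\<not> (i < p \<or> q \<le> i)" using out_d[of i] by metis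
      then show "i \<in> {p..<q}" by simp
    qed
  qed simp
  also have "\<dots> = (\<Sum>i\<in>{p..<s}. (?d i)\<^sup>2) + (\<Sum>i\<in>{s..<q}. (?d i)\<^sup>2)"
    unfolding split by (rule sum.union_disjoint) auto
  finally have "(\<Sum>i\<in>{p..<s}. (?d i)\<^sup>2 + ?d i) + (\<Sum>i\<in>{s..<q}. (?d i)\<^sup>2 - ?d i) = 0"
    by (simp add: sum.distrib sum_subtractf upper lower)
  moreover have nonneg: "0 \<le> x\<^sup>2 + x" "0 \<le> x\<^sup>2 - x" for x :: int
  proof -
    have "0 \<le> x * (x + 1)" "0 \<le> x * (x - 1)" by (auto simp: zero_le_mult_iff)
    then show "0 \<le> x\<^sup>2 + x" "0 \<le> x\<^sup>2 - x" by (simp_all add: power2_eq_square algebra_simps)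
  qed
  moreover have "0 \<le> (\<Sum>i\<in>{p..<s}. (?d i)\<^sup>2 + ?d i)" "0 \<le> (\<Sum>i\<in>{s..<q}. (?d i)\<^sup>2 - ?d i)"
    by (intro sum_nonneg nonneg)+
  ultimately have zero: "(\<Sum>i\<in>{p..<s}. (?d i)\<^sup>2 + ?d i) = 0" "(\<Sum>i\<in>{s..<q}. (?d i)\<^sup>2 - ?d i) = 0"
    by linarith+
  have d_low: "?d i = 0 \<or> ?d i = -1" if "i < s" for i
  proof (cases "p \<le> i")
    case True
    then have "(?d i)\<^sup>2 + ?d i = 0"
      using zero(1) that nonneg by (simp add: sum_nonneg_eq_0_iff)
    then have "?d i * (?d i + 1) = 0" by (simp add: power2_eq_square algebra_simps)
    then show ?thesis by auto
  qed (use out_d in simp)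
  have d_high: "?d i = 0 \<or> ?d i = 1" if "s \<le> i" for i
  proof (cases "i < q")
    case True
    then have "(?d i)\<^sup>2 - ?d i = 0"
      using zero(2) that nonneg by (simp add: sum_nonneg_eq_0_iff)
    then have "?d i * (?d i - 1) = 0" by (simp add: power2_eq_square algebra_simps)
    then show ?thesis by auto
  qed (use out_d in simp)
  define B where "B = {i. i < s \<and> ?d i = 0 \<or> s \<le> i \<and> ?d i = 1}"
  have BP: "B - {..<s} = {i \<in> {s..<q}. ?d i = 1}" and BN: "{..<s} - B = {i \<in> {p..<s}. ?d i = -1}"
  proof -
    have "p \<le> i \<and> i < q" if "?d i \<noteq> 0" for i using out_d[of i] that by linarith
    then show "B - {..<s} = {i \<in> {s..<q}. ?d i = 1}" "{..<s} - B = {i \<in> {p..<s}. ?d i = -1}"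
      using d_low by (auto simp: B_def)
  qed
  have "B - {..<s} \<subseteq> {s..<q}" "{..<s} - B \<subseteq> {p..<s}" unfolding BP BN by auto
  then have fin: "finite (B - {..<s})" "finite ({..<s} - B)" by (meson finite_subset finite_atLeastLessThan_int)+
  have "excess s B (\<lambda>_. 1) = (\<Sum>i\<in>{s..<q}. of_bool (?d i = 1)) - (\<Sum>i\<in>{p..<s}. of_bool (?d i = -1))"
    unfolding excess_def BP BN by (simp add: sum_of_bool_eq Int_def)
  also have "(\<Sum>i\<in>{s..<q}. of_bool (?d i = 1)) = sum ?d {s..<q}"
  proof (rule sum.cong)
    fix i assume "i \<in> {s..<q}"
    then show "of_bool (?d i = 1) = ?d i" using d_high[of i] by auto
  qed simp
  also have "(\<Sum>i\<in>{p..<s}. of_bool (?d i = -1)) = - sum ?d {p..<s}"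
    unfolding sum_negf[symmetric]
  proof (rule sum.cong)
    fix i assume "i \<in> {p..<s}"
    then show "of_bool (?d i = -1) = - ?d i" using d_low[of i] by auto
  qed simp
  finally have "excess s B (\<lambda>_. 1) = 0" by (simp add: upper lower)
  then obtain lam where part: "is_partition lam" and maya: "maya s lam = B"
    using maya_surj[OF fin] by blast
  have "coeff_diff 0 (alpha 0 s lam) i = ?d i" for i
    using coeff_diff_alpha[OF part, of i 0 s] excess_singleton[OF fin, of i] d_low[of i] d_high[of i]
    by (auto simp: Zmod_0 maya B_def of_bool_def)
  then show ?thesis using that part by (simp add: is_core_0_iff)
qed

theorem lemma2p39:
  fixes e :: nat and s :: int
  shows "{alpha e s lam | lam. is_core e lam} = {\<alpha> \<in> carrier (root_lattice e). weight e s \<alpha> = 0}"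
proof (intro equalityI subsetI)
  fix c assume "c \<in> {alpha e s lam | lam. is_core e lam}"
  then show "c \<in> {\<alpha> \<in> carrier (root_lattice e). weight e s \<alpha> = 0}"
    using alpha_in_root_lattice weight_alpha_core by auto
next
  fix c assume "c \<in> {\<alpha> \<in> carrier (root_lattice e). weight e s \<alpha> = 0}"
  then have c: "c \<in> carrier (root_lattice e)" "weight e s c = 0" by auto
  obtain lam where lam: "is_core e lam"
    "\<And>i. i \<in> Zmod e \<Longrightarrow> coeff_diff e (alpha e s lam) i = coeff_diff e c i"
  proof (cases "e = 0")
    case True
    with c(2) have "weight 0 s c = 0" by simp
    then obtain lam where "is_core 0 lam" "\<And>i. coeff_diff 0 (alpha 0 s lam) i = coeff_diff 0 c i"
      by (rule core_with_coeff_diff_0) blast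
    then show ?thesis using that[of lam] True by simp
  next
    case False
    then have "e > 0" by simp
    then show ?thesis by (rule core_with_coeff_diff_pos) (rule that)
  qed
  have "alpha e s lam = c"
    using root_lattice_eqI[OF alpha_in_root_lattice c(1) weight_alpha_core[OF lam(1)] c(2) lam(2)] .
  then show "c \<in> {alpha e s lam | lam. is_core e lam}" using lam(1) by blast
qed

end
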